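(* Let $\mathfrak g$ be an arbitrary root-reductive Lie algebra. The map $\mathfrak b\mapsto\mathfrak n_{\mathfrak g}(\mathfrak b)$ yields a bijection from the set of Borel subalgebras of $[\mathfrak g,\mathfrak g]$ to the set of Borel subalgebras of $\mathfrak g$ whose intersection with $[\mathfrak g,\mathfrak g]$ is a Borel subalgebra of $[\mathfrak g,\mathfrak g]$.
   Context: All Lie algebras are over $\mathbb{C}$. An inclusion of finite-dimensional reductive Lie algebras $\mathfrak l\subseteq\mathfrak m$ is a root inclusion if, for some Cartan subalgebra $\mathfrak h_{\mathfrak m}$ of $\mathfrak m$, the subalgebra $\mathfrak l\cap\mathfrak h_{\mathfrak m}$ is a Cartan subalgebra of $\mathfrak l$ and each $\mathfrak l\cap\mathfrak h_{\mathfrak m}$-root space $\mathfrak l^\alpha$ is also a root space of $\mathfrak m$. A Lie algebra is root-reductive if it is isomorphic to a union $\bigcup_{i\in\mathbb{Z}_{>0}}\mathfrak g_i$ of nested finite-dimensional reductive Lie algebras with respect to root inclusions for a fixed choice of nested Cartan subalgebras $\mathfrak h_i\subseteq\mathfrak g_i$ with $\mathfrak h_{i-1}=\mathfrak h_i\cap\mathfrak g_{i-1}$. A locally finite Lie algebra (every finite subset lies in a finite-dimensional subalgebra) is locally solvable if every finite subset is contained in a solvable subalgebra. A Borel subalgebra is a maximal locally solvable subalgebra. $\mathfrak n_{\mathfrak g}(\mathfrak b)$ denotes the normalizer of $\mathfrak b$ in $\mathfrak g$. *)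

theory Defs
  imports Complex_Main
begin

text \<open>
  Lie algebras are represented as subalgebras \<open>L\<close> of a type of the following class. Such an
  \<open>L\<close> may be \<open>UNIV\<close>, so all complex Lie algebras are covered. The notions below are relative
  to \<open>L\<close>, regarded as a Lie algebra in its own right.
\<close>

class complex_lie_algebra = ab_group_add +
  fixes scaleC :: "complex \<Rightarrow> 'a \<Rightarrow> 'a"
    and bracket :: "'a \<Rightarrow> 'a \<Rightarrow> 'a"
  assumes scaleC_add_right: "scaleC c (x + y) = scaleC c x + scaleC c y"
    and scaleC_add_left: "scaleC (c + d) x = scaleC c x + scaleC d x"
    and scaleC_scaleC: "scaleC c (scaleC d x) = scaleC (c * d) x"
    and scaleC_one: "scaleC 1 x = x"
    and bracket_add_left: "bracket (x + y) z = bracket x z + bracket y z"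
    and bracket_add_right: "bracket x (y + z) = bracket x y + bracket x z"
    and bracket_scaleC_left: "bracket (scaleC c x) y = scaleC c (bracket x y)"
    and bracket_scaleC_right: "bracket x (scaleC c y) = scaleC c (bracket x y)"
    and bracket_self: "bracket x x = 0"
    and jacobi: "bracket x (bracket y z) + bracket y (bracket z x) + bracket z (bracket x y) = 0"

global_interpretation complex_vector:
  vector_space "scaleC :: complex \<Rightarrow> 'a \<Rightarrow> 'a::complex_lie_algebra"
  by unfold_locales
    (rule scaleC_add_right scaleC_add_left scaleC_scaleC scaleC_one)+

definition lie_subalgebra :: "'a::complex_lie_algebra set \<Rightarrow> 'a set \<Rightarrow> bool" where
  "lie_subalgebra K L \<longleftrightarrow>
     K \<subseteq> L \<and> complex_vector.subspace K \<and> (\<forall>x\<in>K. \<forall>y\<in>K. bracket x y \<in> K)"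

definition lie_ideal :: "'a::complex_lie_algebra set \<Rightarrow> 'a set \<Rightarrow> bool" where
  "lie_ideal I L \<longleftrightarrow>
     I \<subseteq> L \<and> complex_vector.subspace I \<and> (\<forall>x\<in>L. \<forall>y\<in>I. bracket x y \<in> I)"

definition fin_dim :: "'a::complex_lie_algebra set \<Rightarrow> bool" where
  "fin_dim L \<longleftrightarrow> (\<exists>B. finite B \<and> L \<subseteq> complex_vector.span B)"

definition bracket_span :: "'a::complex_lie_algebra set \<Rightarrow> 'a set \<Rightarrow> 'a set" where
  "bracket_span A B = complex_vector.span {bracket x y | x y. x \<in> A \<and> y \<in> B}"

definition derived_algebra :: "'a::complex_lie_algebra set \<Rightarrow> 'a set" where
  "derived_algebra L = bracket_span L L"

definition solvable :: "'a::complex_lie_algebra set \<Rightarrow> bool" where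
  "solvable L \<longleftrightarrow> (\<exists>n. (derived_algebra ^^ n) L = {0})"

definition nilpotent :: "'a::complex_lie_algebra set \<Rightarrow> bool" where
  "nilpotent L \<longleftrightarrow> (\<exists>n. (bracket_span L ^^ n) L = {0})"

definition center :: "'a::complex_lie_algebra set \<Rightarrow> 'a set" where
  "center L = {x \<in> L. \<forall>y\<in>L. bracket x y = 0}"

definition normalizer :: "'a::complex_lie_algebra set \<Rightarrow> 'a set \<Rightarrow> 'a set" where
  "normalizer L K = {x \<in> L. \<forall>y\<in>K. bracket x y \<in> K}"

text \<open>
  The sum of all solvable ideals; for finite-dimensional \<open>L\<close> this is the largest solvable ideal.
\<close>

definition radical :: "'a::complex_lie_algebra set \<Rightarrow> 'a set" where
  "radical L = complex_vector.span (\<Union>{I. lie_ideal I L \<and> solvable I})"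

definition fin_dim_reductive :: "'a::complex_lie_algebra set \<Rightarrow> bool" where
  "fin_dim_reductive L \<longleftrightarrow>
     lie_subalgebra L UNIV \<and> fin_dim L \<and> radical L = center L"

definition cartan_subalgebra :: "'a::complex_lie_algebra set \<Rightarrow> 'a set \<Rightarrow> bool" where
  "cartan_subalgebra H L \<longleftrightarrow> lie_subalgebra H L \<and> nilpotent H \<and> normalizer L H = H"

text \<open>
  A linear functional on \<open>H\<close> is encoded as a function on the whole type of which only the
  values on \<open>H\<close> matter. Simultaneous eigenspaces (rather than generalized ones) suffice,
  because a Cartan subalgebra of a finite-dimensional reductive Lie algebra acts diagonalizably.
\<close>

definition weight_space ::
    "'a::complex_lie_algebra set \<Rightarrow> 'a set \<Rightarrow> ('a \<Rightarrow> complex) \<Rightarrow> 'a set" where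
  "weight_space H L \<alpha> = {x \<in> L. \<forall>h\<in>H. bracket h x = scaleC (\<alpha> h) x}"

definition is_root ::
    "'a::complex_lie_algebra set \<Rightarrow> 'a set \<Rightarrow> ('a \<Rightarrow> complex) \<Rightarrow> bool" where
  "is_root H L \<alpha> \<longleftrightarrow>
     (\<forall>x\<in>H. \<forall>y\<in>H. \<alpha> (x + y) = \<alpha> x + \<alpha> y) \<and>
     (\<forall>c. \<forall>x\<in>H. \<alpha> (scaleC c x) = c * \<alpha> x) \<and>
     (\<exists>h\<in>H. \<alpha> h \<noteq> 0) \<and>
     weight_space H L \<alpha> \<noteq> {0}"

definition root_inclusion_wrt ::
    "'a::complex_lie_algebra set \<Rightarrow> 'a set \<Rightarrow> 'a set \<Rightarrow> bool" where
  "root_inclusion_wrt H L M \<longleftrightarrow>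
     fin_dim_reductive L \<and> fin_dim_reductive M \<and> lie_subalgebra L M \<and>
     cartan_subalgebra H M \<and> cartan_subalgebra (L \<inter> H) L \<and>
     (\<forall>\<alpha>. is_root (L \<inter> H) L \<alpha> \<longrightarrow>
       (\<exists>\<beta>. is_root H M \<beta> \<and> weight_space (L \<inter> H) L \<alpha> = weight_space H M \<beta>))"

text \<open>
  A Lie algebra isomorphic to a union of the required kind is itself such a union, of the
  images of the terms under the isomorphism; so no isomorphism appears in the definition.
\<close>

definition root_reductive :: "'a::complex_lie_algebra set \<Rightarrow> bool" where
  "root_reductive L \<longleftrightarrow>
     (\<exists>G H :: nat \<Rightarrow> 'a set.
        L = (\<Union>i. G i) \<and>
        (\<forall>i. lie_subalgebra (G i) L \<and> fin_dim_reductive (G i)) \<and>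
        (\<forall>i. cartan_subalgebra (H i) (G i)) \<and>
        (\<forall>i. H i = H (Suc i) \<inter> G i) \<and>
        (\<forall>i. root_inclusion_wrt (H (Suc i)) (G i) (G (Suc i))))"

definition locally_finite :: "'a::complex_lie_algebra set \<Rightarrow> bool" where
  "locally_finite L \<longleftrightarrow>
     (\<forall>S. finite S \<and> S \<subseteq> L \<longrightarrow> (\<exists>K. lie_subalgebra K L \<and> fin_dim K \<and> S \<subseteq> K))"

definition locally_solvable :: "'a::complex_lie_algebra set \<Rightarrow> bool" where
  "locally_solvable L \<longleftrightarrow> locally_finite L \<and>
     (\<forall>S. finite S \<and> S \<subseteq> L \<longrightarrow> (\<exists>K. lie_subalgebra K L \<and> solvable K \<and> S \<subseteq> K))"

definition borel_subalgebra :: "'a::complex_lie_algebra set \<Rightarrow> 'a set \<Rightarrow> bool" where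
  "borel_subalgebra B L \<longleftrightarrow>
     lie_subalgebra B L \<and> locally_solvable B \<and>
     (\<forall>K. lie_subalgebra K L \<and> locally_solvable K \<and> B \<subseteq> K \<longrightarrow> K = B)"

end

theory Submission
  imports Defs
begin

text \<open>
  The algebra \<open>\<gg>\<close> is locally finite, and in such an algebra a subalgebra whose brackets
  all lie in a locally solvable subalgebra is itself locally solvable. Applied to \<open>\<bb> + \<complex>x\<close>, this
  shows that a Borel subalgebra \<open>\<bb>\<close> of \<open>[\<gg>,\<gg>]\<close> is self-normalizing there, so the normalizer of
  \<open>\<bb>\<close> in \<open>\<gg>\<close> meets \<open>[\<gg>,\<gg>]\<close> in \<open>\<bb>\<close>. Applied to that normalizer, whose brackets lie in this
  intersection, it shows that the normalizer is locally solvable. Finally, any subalgebra of \<open>\<gg>\<close>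
  normalizes its intersection with the ideal \<open>[\<gg>,\<gg>]\<close>, which gives maximality and surjectivity.
\<close>

section \<open>Bracket identities and subalgebras\<close>

lemma bracket_zero_left: "bracket 0 x = (0::'a::complex_lie_algebra)"
  using bracket_add_left[of 0 0 x] by simp

lemma bracket_minus_left: "bracket (- x) y = - bracket x (y::'a::complex_lie_algebra)"
  using bracket_add_left[of x "- x" y] by (simp add: bracket_zero_left eq_neg_iff_add_eq_0 add.commute)

lemma bracket_swap: "bracket x y = - bracket y (x::'a::complex_lie_algebra)"
proof -
  have "0 = bracket x (x + y) + bracket y (x + y)"
    using bracket_add_left[of x y "x + y"] unfolding bracket_self .
  then have "bracket x y + bracket y x = 0"
    by (simp add: bracket_add_right bracket_self)
  then show ?thesis by (simp add: eq_neg_iff_add_eq_0)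
qed

text \<open>The Jacobi identity, read as saying that the adjoint map is a representation. In this
  form it yields closure of normalizers under the bracket.\<close>

lemma bracket_bracket:
  "bracket (bracket x y) z = bracket x (bracket y z) - bracket y (bracket x (z::'a::complex_lie_algebra))"
proof -
  have "bracket y (bracket z x) = - bracket y (bracket x z)"
    using bracket_swap[of z x] bracket_swap[of y "bracket z x"] bracket_swap[of y "bracket x z"]
    by (metis bracket_minus_left)
  then show ?thesis
    using jacobi[of x y z] bracket_swap[of z "bracket x y"] by (simp add: algebra_simps)
qed

lemma lie_subalgebra_Int:
  assumes "lie_subalgebra K UNIV" "lie_subalgebra M L"
  shows "lie_subalgebra (K \<inter> M) L"
  using assms complex_vector.subspace_inter[of K M] unfolding lie_subalgebra_def by auto

lemma lie_subalgebra_mono: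
  assumes "lie_subalgebra K L" "K \<subseteq> M" shows "lie_subalgebra K M"
  using assms unfolding lie_subalgebra_def by auto

lemma lie_subalgebra_subset: "lie_subalgebra K L \<Longrightarrow> K \<subseteq> L"
  unfolding lie_subalgebra_def by blast

section \<open>Derived algebras and solvability\<close>

lemma derived_algebra_mono: "K \<subseteq> L \<Longrightarrow> derived_algebra K \<subseteq> derived_algebra L"
  unfolding derived_algebra_def bracket_span_def by (intro complex_vector.span_mono) blast

lemma bracket_in_derived_algebra: "x \<in> L \<Longrightarrow> y \<in> L \<Longrightarrow> bracket x y \<in> derived_algebra L"
  unfolding derived_algebra_def bracket_span_def by (intro complex_vector.span_base) blast

lemma derived_algebra_subset:
  assumes "complex_vector.subspace M" "\<And>x y. x \<in> L \<Longrightarrow> y \<in> L \<Longrightarrow> bracket x y \<in> M"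
  shows "derived_algebra L \<subseteq> M"
  unfolding derived_algebra_def bracket_span_def
  using assms by (intro complex_vector.span_minimal) auto

lemma lie_subalgebra_derived_algebra:
  assumes "lie_subalgebra L UNIV"
  shows "lie_subalgebra (derived_algebra L) L"
proof -
  have "derived_algebra L \<subseteq> L"
    using assms by (intro derived_algebra_subset) (auto simp: lie_subalgebra_def)
  moreover have "complex_vector.subspace (derived_algebra L)"
    unfolding derived_algebra_def bracket_span_def by simp
  ultimately show ?thesis
    unfolding lie_subalgebra_def by (blast intro: bracket_in_derived_algebra)
qed

lemma subspace_funpow_derived_algebra:
  "complex_vector.subspace L \<Longrightarrow> complex_vector.subspace ((derived_algebra ^^ n) L)"
  by (cases n) (auto simp: derived_algebra_def bracket_span_def)

text \<open>\<open>derived_algebra\<close> is monotone on arbitrary sets, so \<open>K\<close> may be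
  a mere subspace. Being one puts 0 into every term of its derived series, so a term contained in
  \<open>{0}\<close> equals it.\<close>

lemma solvable_subset:
  assumes "solvable L" "K \<subseteq> L" "complex_vector.subspace K"
  shows "solvable K"
proof -
  obtain n where "(derived_algebra ^^ n) L = {0}"
    using assms(1) unfolding solvable_def by blast
  moreover have "(derived_algebra ^^ n) K \<subseteq> (derived_algebra ^^ n) L"
    using assms(2) by (induction n) (auto intro: derived_algebra_mono[THEN subsetD])
  moreover have "0 \<in> (derived_algebra ^^ n) K"
    using subspace_funpow_derived_algebra[OF assms(3)] by (rule complex_vector.subspace_0)
  ultimately have "(derived_algebra ^^ n) K = {0}" by blast
  then show ?thesis unfolding solvable_def by blast
qed

lemma solvable_if_derived_algebra_solvable:
  assumes "solvable (derived_algebra L)" shows "solvable L"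
proof -
  obtain n where "(derived_algebra ^^ n) (derived_algebra L) = {0}"
    using assms unfolding solvable_def by blast
  then have "(derived_algebra ^^ Suc n) L = {0}" by (simp only: funpow_Suc_right o_apply)
  then show ?thesis unfolding solvable_def by blast
qed

section \<open>Finite dimension and local conditions\<close>

lemma fin_dim_subset: "fin_dim L \<Longrightarrow> K \<subseteq> L \<Longrightarrow> fin_dim K"
  unfolding fin_dim_def by blast

text \<open>\<open>fin_dim\<close> lets the spanning set leave \<open>V\<close>, whereas local
  solvability speaks of finite subsets of the algebra itself. The spanning set is therefore moved
  inside \<open>V\<close>.\<close>

lemma fin_dim_finite_basis:
  assumes "fin_dim V"
  obtains B where "finite B" "B \<subseteq> V" "V \<subseteq> complex_vector.span B"
proof -
  obtain C where C: "finite C" "V \<subseteq> complex_vector.span C"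
    using assms unfolding fin_dim_def by blast
  obtain B where B: "B \<subseteq> V" "complex_vector.independent B" "V \<subseteq> complex_vector.span B"
    using complex_vector.maximal_independent_subset by blast
  have "finite B"
    using complex_vector.independent_span_bound[OF C(1) B(2)] B(1) C(2) by blast
  then show ?thesis using that B by blast
qed

lemma locally_finite_subalgebra:
  assumes "locally_finite L" "lie_subalgebra K L"
  shows "locally_finite K"
  unfolding locally_finite_def
proof (intro allI impI)
  fix S assume S: "finite S \<and> S \<subseteq> K"
  then obtain F where F: "lie_subalgebra F L" "fin_dim F" "S \<subseteq> F"
    using assms(1) lie_subalgebra_subset[OF assms(2)] unfolding locally_finite_def by blast
  have "lie_subalgebra (F \<inter> K) K"
    using F(1) assms(2) by (meson lie_subalgebra_Int lie_subalgebra_mono inf_le2 subset_UNIV)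
  moreover have "fin_dim (F \<inter> K)" using F(2) by (rule fin_dim_subset) blast
  ultimately show "\<exists>M. lie_subalgebra M K \<and> fin_dim M \<and> S \<subseteq> M" using S F(3) by blast
qed

text \<open>A finite spanning set of \<open>K\<close> lies in a single solvable subalgebra of
  \<open>L\<close>, which then contains all of \<open>K\<close>.\<close>

lemma fin_dim_locally_solvable:
  assumes "locally_solvable L" "K \<subseteq> L" "complex_vector.subspace K" "fin_dim K"
  shows "solvable K"
proof -
  obtain B where B: "finite B" "B \<subseteq> K" "K \<subseteq> complex_vector.span B"
    using fin_dim_finite_basis[OF assms(4)] .
  then obtain M where M: "lie_subalgebra M L" "solvable M" "B \<subseteq> M"
    using assms(1,2) unfolding locally_solvable_def by (meson order_trans)
  have "complex_vector.span B \<subseteq> M"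
    using M by (intro complex_vector.span_minimal) (auto simp: lie_subalgebra_def)
  then show ?thesis using solvable_subset[OF M(2)] B(3) assms(3) by blast
qed

text \<open>By local finiteness a finite set lies in a finite-dimensional subalgebra
  \<open>F\<close> of \<open>K\<close>. The derived algebra of \<open>F\<close> is a
  finite-dimensional subspace of \<open>B\<close>, hence solvable, and prepending one term to its
  derived series makes \<open>F\<close> solvable.\<close>

lemma locally_solvable_if_brackets:
  assumes "locally_finite K" "locally_solvable B" "complex_vector.subspace B"
    and "\<And>x y. x \<in> K \<Longrightarrow> y \<in> K \<Longrightarrow> bracket x y \<in> B"
  shows "locally_solvable K"
  unfolding locally_solvable_def
proof (intro conjI allI impI)
  fix S assume S: "finite S \<and> S \<subseteq> K"
  obtain F where F: "lie_subalgebra F K" "fin_dim F" "S \<subseteq> F"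
    using assms(1) S unfolding locally_finite_def by blast
  have D: "lie_subalgebra (derived_algebra F) F"
    using F(1) by (meson lie_subalgebra_derived_algebra lie_subalgebra_mono subset_UNIV)
  have "derived_algebra F \<subseteq> B"
    using assms(3,4) lie_subalgebra_subset[OF F(1)] by (intro derived_algebra_subset) auto
  moreover have "fin_dim (derived_algebra F)"
    using F(2) lie_subalgebra_subset[OF D] by (rule fin_dim_subset)
  ultimately have "solvable (derived_algebra F)"
    using fin_dim_locally_solvable[OF assms(2)] D unfolding lie_subalgebra_def by blast
  then show "\<exists>F. lie_subalgebra F K \<and> solvable F \<and> S \<subseteq> F"
    using F solvable_if_derived_algebra_solvable by blast
qed (rule assms(1))

text \<open>Local finiteness passes to \<open>K\<close>, and a finite-dimensional subalgebra of
  \<open>K\<close> is a finite-dimensional subspace of \<open>L\<close>, hence solvable.\<close>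

lemma locally_solvable_subalgebra:
  assumes "locally_solvable L" "lie_subalgebra K L"
  shows "locally_solvable K"
  unfolding locally_solvable_def
proof (intro conjI allI impI)
  show lf: "locally_finite K"
    using assms locally_finite_subalgebra unfolding locally_solvable_def by blast
  fix S assume "finite S \<and> S \<subseteq> K"
  then obtain F where F: "lie_subalgebra F K" "fin_dim F" "S \<subseteq> F"
    using lf unfolding locally_finite_def by blast
  then have "solvable F"
    using assms by (intro fin_dim_locally_solvable[OF assms(1)]) (auto simp: lie_subalgebra_def)
  then show "\<exists>F. lie_subalgebra F K \<and> solvable F \<and> S \<subseteq> F" using F by blast
qed

section \<open>Normalizers and Borel subalgebras\<close>

lemma subspace_normalizer:
  assumes "complex_vector.subspace L" "complex_vector.subspace K"
  shows "complex_vector.subspace (normalizer L K)"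
  using assms unfolding complex_vector.subspace_def normalizer_def
  by (auto simp: bracket_zero_left bracket_add_left bracket_scaleC_left)

lemma lie_subalgebra_normalizer:
  assumes "lie_subalgebra L UNIV" "complex_vector.subspace K"
  shows "lie_subalgebra (normalizer L K) L"
  using assms subspace_normalizer[of L K] unfolding lie_subalgebra_def
  by (auto simp: normalizer_def bracket_bracket intro: complex_vector.subspace_diff)

text \<open>Brackets of elements of \<open>K\<close> stay in \<open>K\<close>, and all brackets in
  \<open>L\<close> lie in \<open>derived_algebra L\<close>.\<close>

lemma subset_normalizer_Int_derived:
  assumes "K \<subseteq> L" "\<And>x y. x \<in> K \<Longrightarrow> y \<in> K \<Longrightarrow> bracket x y \<in> K"
  shows "K \<subseteq> normalizer L (K \<inter> derived_algebra L)"
  using assms by (auto simp: normalizer_def intro: bracket_in_derived_algebra)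

lemma borel_self_normalizing:
  assumes L: "lie_subalgebra L UNIV" "locally_finite L" and B: "borel_subalgebra B L"
  shows "normalizer L B = B"
proof
  have BL: "B \<subseteq> L" "complex_vector.subspace B" "\<And>x y. x \<in> B \<Longrightarrow> y \<in> B \<Longrightarrow> bracket x y \<in> B"
    and ls: "locally_solvable B"
    and mx: "\<And>K. lie_subalgebra K L \<Longrightarrow> locally_solvable K \<Longrightarrow> B \<subseteq> K \<Longrightarrow> K = B"
    using B unfolding borel_subalgebra_def lie_subalgebra_def by auto
  show "B \<subseteq> normalizer L B" using BL unfolding normalizer_def by auto
  show "normalizer L B \<subseteq> B"
  proof
    fix x assume x: "x \<in> normalizer L B"
    \<comment> \<open>Once \<open>K\<close> is known to be a locally solvable subalgebra, maximality
      of \<open>B\<close> forces \<open>K = B\<close>, which contains \<open>x\<close>.\<close>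
    define K where "K = complex_vector.span (insert x B)"
    have BK: "B \<subseteq> K" and xK: "x \<in> K"
      unfolding K_def by (auto intro: complex_vector.span_base)
    have spanB: "complex_vector.span B = B"
      using BL(2) by (simp add: complex_vector.span_eq_iff)
    have xB: "bracket x u \<in> B" if "u \<in> B" for u
      using x that unfolding normalizer_def by blast
    \<comment> \<open>Modulo \<open>B\<close> both arguments are multiples of \<open>x\<close>.
      Since \<open>x\<close> normalizes \<open>B\<close> and has zero bracket with itself, every
      term of the expanded bracket lies in \<open>B\<close>.\<close>
    have brK: "bracket y z \<in> B" if yz: "y \<in> K" "z \<in> K" for y z
    proof -
      obtain k l where kl: "y - scaleC k x \<in> B" "z - scaleC l x \<in> B"
        using yz unfolding K_def complex_vector.span_insert spanB mem_Collect_eq by blast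
      define u v where "u = y - scaleC k x" and "v = z - scaleC l x"
      have uv: "u \<in> B" "v \<in> B" "y = u + scaleC k x" "z = v + scaleC l x"
        using kl by (simp_all add: u_def v_def)
      have "bracket y z = bracket u v + scaleC l (- bracket x u) + scaleC k (bracket x v)"
        unfolding uv(3,4) using bracket_swap[of u x]
        by (simp add: bracket_add_left bracket_add_right bracket_scaleC_left
            bracket_scaleC_right bracket_self)
      then show ?thesis
        using uv(1,2) BL xB by (simp add: complex_vector.subspace_add
            complex_vector.subspace_scale complex_vector.subspace_diff)
    qed
    have "K \<subseteq> L"
      unfolding K_def using L(1) BL(1) x
      by (intro complex_vector.span_minimal) (auto simp: lie_subalgebra_def normalizer_def)
    then have K: "lie_subalgebra K L"
      unfolding lie_subalgebra_def using brK BK by (auto simp: K_def)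
    have "locally_solvable K"
      using locally_finite_subalgebra[OF L(2) K] ls BL(2) brK
      by (rule locally_solvable_if_brackets)
    then show "x \<in> B" using mx[OF K] BK xK by blast
  qed
qed

lemma normalizer_borel_derived:
  assumes g: "lie_subalgebra L UNIV" "locally_finite L"
    and B: "borel_subalgebra B (derived_algebra L)"
  shows "normalizer L B \<inter> derived_algebra L = B" (is ?int)
    and "borel_subalgebra (normalizer L B) L" (is ?borel)
proof -
  let ?D = "derived_algebra L"
  have D: "lie_subalgebra ?D L" using g(1) by (rule lie_subalgebra_derived_algebra)
  have sub: "complex_vector.subspace B" and ls: "locally_solvable B"
    and mx: "\<And>K. lie_subalgebra K ?D \<Longrightarrow> locally_solvable K \<Longrightarrow> B \<subseteq> K \<Longrightarrow> K = B"
    using B unfolding borel_subalgebra_def lie_subalgebra_def by auto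
  have "normalizer ?D B = B"
    using D g B locally_finite_subalgebra by (intro borel_self_normalizing)
      (auto intro: lie_subalgebra_mono)
  then show int: ?int
    using lie_subalgebra_subset[OF D] unfolding normalizer_def by blast
  have N: "lie_subalgebra (normalizer L B) L"
    using g(1) sub by (rule lie_subalgebra_normalizer)
  \<comment> \<open>The normalizer is a subalgebra, so the bracket lies in it as well as in
    \<open>?D\<close>, and these two meet in \<open>B\<close>.\<close>
  have "bracket x y \<in> B" if "x \<in> normalizer L B" "y \<in> normalizer L B" for x y
    using that N int bracket_in_derived_algebra[of x L y]
    unfolding lie_subalgebra_def by blast
  with locally_finite_subalgebra[OF g(2) N] ls sub
  have lsN: "locally_solvable (normalizer L B)" by (rule locally_solvable_if_brackets)
  have "K = normalizer L B"
    if K: "lie_subalgebra K L" "locally_solvable K" "normalizer L B \<subseteq> K" for K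
  proof
    \<comment> \<open>The trace of \<open>K\<close> on \<open>?D\<close> is locally solvable and
      contains \<open>B\<close>, so it equals \<open>B\<close> by maximality. As \<open>K\<close>
      normalizes this trace, it lies in the normalizer of \<open>B\<close>.\<close>
    have KD: "lie_subalgebra (K \<inter> ?D) ?D" "lie_subalgebra (K \<inter> ?D) K"
      using K(1) D by (meson lie_subalgebra_Int lie_subalgebra_mono inf_le1 inf_le2 subset_UNIV)+
    then have "K \<inter> ?D = B"
      using mx locally_solvable_subalgebra[OF K(2)] K(3) int by blast
    then show "K \<subseteq> normalizer L B"
      using K(1) subset_normalizer_Int_derived[of K L] unfolding lie_subalgebra_def by auto
  qed (rule K(3))
  with N lsN show ?borel unfolding borel_subalgebra_def by blast
qed

text \<open>The reductive terms form an increasing chain of finite-dimensional subalgebras, so a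
  finite subset of the union already lies in one term.\<close>

lemma root_reductive_locally_finite:
  assumes "root_reductive L" shows "locally_finite L"
proof -
  obtain G :: "nat \<Rightarrow> 'a set" where G: "L = (\<Union>i. G i)"
    "\<And>i. lie_subalgebra (G i) L" "\<And>i. fin_dim (G i)" "\<And>i. G i \<subseteq> G (Suc i)"
    using assms unfolding root_reductive_def root_inclusion_wrt_def fin_dim_reductive_def
    by (metis lie_subalgebra_subset)
  show ?thesis
    unfolding locally_finite_def
  proof (intro allI impI)
    fix S assume S: "finite S \<and> S \<subseteq> L"
    then have "finite S" "S \<subseteq> L" by auto
    then have "\<exists>i. S \<subseteq> G i"
    proof (induction S)
      case (insert x S)
      then obtain i j where "S \<subseteq> G i" "x \<in> G j" using G(1) by auto
      moreover have "G i \<subseteq> G (max i j)" "G j \<subseteq> G (max i j)"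
        using lift_Suc_mono_le[of G, OF G(4)] by auto
      ultimately show ?case by blast
    qed simp
    then show "\<exists>K. lie_subalgebra K L \<and> fin_dim K \<and> S \<subseteq> K" using G(2,3) by blast
  qed
qed

theorem theorem4p18:
  fixes \<gg> :: "'a::complex_lie_algebra set"
  assumes "lie_subalgebra \<gg> UNIV" and "root_reductive \<gg>"
  shows "bij_betw (normalizer \<gg>)
           {\<bb>. borel_subalgebra \<bb> (derived_algebra \<gg>)}
           {B. borel_subalgebra B \<gg> \<and>
               borel_subalgebra (B \<inter> derived_algebra \<gg>) (derived_algebra \<gg>)}"
proof (rule bij_betw_byWitness[where f' = "\<lambda>B. B \<inter> derived_algebra \<gg>"])
  let ?D = "derived_algebra \<gg>"
  let ?S = "{\<bb>. borel_subalgebra \<bb> ?D}"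
  let ?T = "{B. borel_subalgebra B \<gg> \<and> borel_subalgebra (B \<inter> ?D) ?D}"
  note nb = normalizer_borel_derived[OF assms(1) root_reductive_locally_finite[OF assms(2)]]
  show "\<forall>\<bb>\<in>?S. normalizer \<gg> \<bb> \<inter> ?D = \<bb>" using nb(1) by simp
  show "normalizer \<gg> ` ?S \<subseteq> ?T" using nb by auto
  show "(\<lambda>B. B \<inter> ?D) ` ?T \<subseteq> ?S" by auto
  \<comment> \<open>\<open>B\<close> lies in the normalizer of its trace on \<open>?D\<close>. That
    trace is Borel in \<open>?D\<close>, so the normalizer is locally solvable, and maximality of
    \<open>B\<close> gives equality.\<close>
  show "\<forall>B\<in>?T. normalizer \<gg> (B \<inter> ?D) = B"
  proof
    fix B assume "B \<in> ?T"
    then have B: "borel_subalgebra B \<gg>" "borel_subalgebra (B \<inter> ?D) ?D" by auto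
    have "B \<subseteq> normalizer \<gg> (B \<inter> ?D)"
      using B(1) unfolding borel_subalgebra_def lie_subalgebra_def
      by (intro subset_normalizer_Int_derived) auto
    moreover have "lie_subalgebra (normalizer \<gg> (B \<inter> ?D)) \<gg>"
      "locally_solvable (normalizer \<gg> (B \<inter> ?D))"
      using nb(2)[OF B(2)] by (auto simp: borel_subalgebra_def)
    ultimately show "normalizer \<gg> (B \<inter> ?D) = B"
      using B(1) unfolding borel_subalgebra_def by simp
  qed
qed

end
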